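(* Let $n\ge 1$, let $B$ be an $n$-braid and let $X$ be a finite rack with $|X|=m$. Let $\widehat{B}$ denote the closure of $B$. Then the rack counting invariant of $\widehat{B}$ with respect to $X$ is given by $$\mathrm{Col}_X(\widehat{B})=\bigl|\mathrm{Hom}(\mathcal{FR}(\widehat{B}), X)\bigr| = \operatorname{tr}\left( \Phi_X^{M_{m^n}}(B) \right).$$
   Context: A rack is a set $X$ with a binary operation $\triangleright: X\times X\to X$ such that (1) for all $y\in X$ the map $\beta_y(x)=x\triangleright y$ is a bijection of $X$, with $\beta_y^{-1}(x)$ denoted $x\triangleright^{-1}y$; and (2) $(x\triangleright y)\triangleright z=(x\triangleright z)\triangleright(y\triangleright z)$ for all $x,y,z\in X$. A rack homomorphism is a map $\phi$ with $\phi(x_1\triangleright x_2)=\phi(x_1)\triangleright\phi(x_2)$; $\mathrm{Hom}$ denotes the set of rack homomorphisms. The $n$-braid group $B_n$ is generated by $\sigma_1,\dots,\sigma_{n-1}$ with relations $\sigma_i\sigma_j=\sigma_j\sigma_i$ for $|i-j|\ge 2$ and $\sigma_i\sigma_{i+1}\sigma_i=\sigma_{i+1}\sigma_i\sigma_{i+1}$ for $1\le i\le n-2$. An $n$-braid is an element of $B_n$; it is represented by braid words (diagrams) in the $\sigma_i^{\pm1}$, read from left to right as crossings from top to bottom. All braids are oriented downward. Coloring rule: at a crossing $\sigma_i$ (the $i$-th strand passes under the $(i+1)$-st), if the labels in positions $(i,i+1)$ above the crossing are $(x,y)$, then below they are $(y,\,x\triangleright y)$; at a crossing $\sigma_i^{-1}$,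 if the labels in positions $(i,i+1)$ above are $(y,x)$, then below they are $(x\triangleright^{-1}y,\,y)$; the labels in all other positions are unchanged. A top coloring in $X^n$ extends to a unique bottom coloring in $X^n$, depending only on the braid and not on the representing word. For a finite rack $X$ with $|X|=m$ and an $n$-braid $B$, the rack counting matrix $\Phi_X^{M_{m^n}}(B)$ is the $m^n\times m^n$ matrix with rows and columns indexed by $X^n$, whose $(i,j)$-entry ($i,j\in X^n$) is $1$ if the top coloring $i$ extends through $B$ to the bottom coloring $j$, and $0$ otherwise. The closure $\widehat{B}$ is the oriented framed link obtained from a diagram of $B$ by joining, for each $i$, the $i$-th bottom endpoint to the $i$-th top endpoint by arcs with no further crossings, with the blackboard framing of the resulting diagram. The fundamental rack $\mathcal{FR}(L)$ of an oriented framed link $L$ with diagram $D$ is the rack presented by one generator for each arc of $D$ and one relation for each crossing, namely the relation imposed by the coloring rule at that crossing. Concretely, for a braid word $w$ of length $\ell$ representing $B$, $\mathcal{FR}(\widehat B)$ is the rack presented by generators $a_{k,i}$ ($0\le k\le \ell$, $1\le i\le n$; the label in position $i$ after the first $k$ crossings), with relations stating that $(a_{k,1},\dots,a_{k,n})$ is obtained from $(a_{k-1,1},\dots,a_{k-1,n})$ by the coloring rule for the $k$-th letter of $w$, together with $a_{\ell,i}=a_{0,i}$ for all $i$. The rack counting invariant of $L$ is $\mathrm{Col}_X(L)=|\mathrm{Hom}(\mathcal{FR}(L),X)|$. *)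

theory Defs
  imports "HOL-Algebra.Group"
begin

section \<open>Racks\<close>

record 'a rack = "'a partial_object" +
  rack_op :: "'a \<Rightarrow> 'a \<Rightarrow> 'a" (infixl "\<triangleright>\<index>" 70)

locale rack =
  fixes X (structure)
  assumes right_bij: "y \<in> carrier X \<Longrightarrow> bij_betw (\<lambda>x. x \<triangleright> y) (carrier X) (carrier X)"
    and distrib: "\<lbrakk>x \<in> carrier X; y \<in> carrier X; z \<in> carrier X\<rbrakk>
      \<Longrightarrow> (x \<triangleright> y) \<triangleright> z = (x \<triangleright> z) \<triangleright> (y \<triangleright> z)"

definition rack_inv_op :: "('a, 'b) rack_scheme \<Rightarrow> 'a \<Rightarrow> 'a \<Rightarrow> 'a"
  where "rack_inv_op X x y = inv_into (carrier X) (\<lambda>z. z \<triangleright>\<^bsub>X\<^esub> y) x"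

text \<open>Homomorphisms are taken extensional, so that each map between the carriers is
  represented by exactly one function and cardinalities of Hom sets are meaningful.\<close>

definition rack_hom :: "('a, 'c) rack_scheme \<Rightarrow> ('b, 'd) rack_scheme \<Rightarrow> ('a \<Rightarrow> 'b) set"
  where "rack_hom X Y = {\<phi> \<in> carrier X \<rightarrow>\<^sub>E carrier Y.
    \<forall>x\<in>carrier X. \<forall>y\<in>carrier X. \<phi> (x \<triangleright>\<^bsub>X\<^esub> y) = \<phi> x \<triangleright>\<^bsub>Y\<^esub> \<phi> y}"

lemma (in rack) op_closed: "\<lbrakk>x \<in> carrier X; y \<in> carrier X\<rbrakk> \<Longrightarrow> x \<triangleright> y \<in> carrier X"
  using right_bij bij_betwE by fastforce

lemma (in rack) inv_op_closed:
  "\<lbrakk>x \<in> carrier X; y \<in> carrier X\<rbrakk> \<Longrightarrow> rack_inv_op X x y \<in> carrier X"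
  unfolding rack_inv_op_def using right_bij[of y]
  by (metis bij_betw_def inv_into_into)

lemma (in rack) inv_op_op:
  "\<lbrakk>x \<in> carrier X; y \<in> carrier X\<rbrakk> \<Longrightarrow> rack_inv_op X x y \<triangleright> y = x"
  unfolding rack_inv_op_def using right_bij[of y] bij_betw_inv_into_right by fastforce

lemma (in rack) op_inv_op:
  "\<lbrakk>x \<in> carrier X; y \<in> carrier X\<rbrakk> \<Longrightarrow> rack_inv_op X (x \<triangleright> y) y = x"
  unfolding rack_inv_op_def using right_bij[of y] bij_betw_inv_into_left by fastforce


section \<open>Racks presented by generators and relations\<close>

datatype 'g rack_term =
    Var 'g
  | Op "'g rack_term" "'g rack_term"
  | InvOp "'g rack_term" "'g rack_term"

definition rack_terms :: "'g set \<Rightarrow> 'g rack_term set"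
  where "rack_terms G = {t. set_rack_term t \<subseteq> G}"

inductive_set rack_cong :: "'g set \<Rightarrow> ('g rack_term \<times> 'g rack_term) set
    \<Rightarrow> ('g rack_term \<times> 'g rack_term) set"
  for G :: "'g set" and R :: "('g rack_term \<times> 'g rack_term) set"
  where
    relation: "\<lbrakk>(s, t) \<in> R; s \<in> rack_terms G; t \<in> rack_terms G\<rbrakk> \<Longrightarrow> (s, t) \<in> rack_cong G R"
  | refl: "t \<in> rack_terms G \<Longrightarrow> (t, t) \<in> rack_cong G R"
  | sym: "(s, t) \<in> rack_cong G R \<Longrightarrow> (t, s) \<in> rack_cong G R"
  | trans: "\<lbrakk>(s, t) \<in> rack_cong G R; (t, u) \<in> rack_cong G R\<rbrakk> \<Longrightarrow> (s, u) \<in> rack_cong G R"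
  | op: "\<lbrakk>(s, s') \<in> rack_cong G R; (t, t') \<in> rack_cong G R\<rbrakk>
      \<Longrightarrow> (Op s t, Op s' t') \<in> rack_cong G R"
  | inv_op: "\<lbrakk>(s, s') \<in> rack_cong G R; (t, t') \<in> rack_cong G R\<rbrakk>
      \<Longrightarrow> (InvOp s t, InvOp s' t') \<in> rack_cong G R"
  | op_inv_op: "\<lbrakk>s \<in> rack_terms G; t \<in> rack_terms G\<rbrakk>
      \<Longrightarrow> (InvOp (Op s t) t, s) \<in> rack_cong G R"
  | inv_op_op: "\<lbrakk>s \<in> rack_terms G; t \<in> rack_terms G\<rbrakk>
      \<Longrightarrow> (Op (InvOp s t) t, s) \<in> rack_cong G R"
  | distrib: "\<lbrakk>s \<in> rack_terms G; t \<in> rack_terms G; u \<in> rack_terms G\<rbrakk>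
      \<Longrightarrow> (Op (Op s t) u, Op (Op s u) (Op t u)) \<in> rack_cong G R"

definition presented_rack :: "'g set \<Rightarrow> ('g rack_term \<times> 'g rack_term) set
    \<Rightarrow> 'g rack_term set rack"
  where "presented_rack G R =
    \<lparr>carrier = rack_terms G // rack_cong G R,
     rack_op = (\<lambda>A B. \<Union>s\<in>A. \<Union>t\<in>B. rack_cong G R `` {Op s t})\<rparr>"

lemma rack_terms_simps [simp]:
  "Var g \<in> rack_terms G \<longleftrightarrow> g \<in> G"
  "Op s t \<in> rack_terms G \<longleftrightarrow> s \<in> rack_terms G \<and> t \<in> rack_terms G"
  "InvOp s t \<in> rack_terms G \<longleftrightarrow> s \<in> rack_terms G \<and> t \<in> rack_terms G"
  by (auto simp: rack_terms_def)

lemma equiv_rack_cong: "equiv (rack_terms G) (rack_cong G R)"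
proof (rule equivI)
  have "(s, t) \<in> rack_cong G R \<Longrightarrow> s \<in> rack_terms G \<and> t \<in> rack_terms G" for s t
    by (induction rule: rack_cong.induct) auto
  then show "rack_cong G R \<subseteq> rack_terms G \<times> rack_terms G" by auto
  show "refl_on (rack_terms G) (rack_cong G R)"
    by (auto simp: refl_on_def intro: rack_cong.refl)
  show "sym (rack_cong G R)"
    by (intro symI) (rule rack_cong.sym)
  show "trans (rack_cong G R)"
    by (intro transI) (rule rack_cong.trans)
qed

lemma presented_rack_op:
  assumes "s \<in> rack_terms G" "t \<in> rack_terms G"
  shows "rack_op (presented_rack G R) (rack_cong G R `` {s}) (rack_cong G R `` {t})
    = rack_cong G R `` {Op s t}"
proof -
  have "congruent2 (rack_cong G R) (rack_cong G R) (\<lambda>s t. rack_cong G R `` {Op s t})"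
    by (intro congruent2I' equiv_class_eq[OF equiv_rack_cong] rack_cong.op)
  then show ?thesis
    using assms by (simp add: presented_rack_def UN_equiv_class2[OF equiv_rack_cong equiv_rack_cong])
qed

lemma rack_presented_rack: "rack (presented_rack G R)"
proof
  let ?P = "presented_rack G R" and ?c = "\<lambda>t. rack_cong G R `` {t}"
  have carr: "carrier ?P = ?c ` rack_terms G"
    by (auto simp: presented_rack_def quotient_def)
  have eqI: "?c s = ?c t" if "(s, t) \<in> rack_cong G R" for s t
    using that equiv_class_eq[OF equiv_rack_cong] by metis
  show "bij_betw (\<lambda>x. x \<triangleright>\<^bsub>?P\<^esub> y) (carrier ?P) (carrier ?P)" if y: "y \<in> carrier ?P" for y
  proof -
    obtain t where t: "t \<in> rack_terms G" "y = ?c t" using y unfolding carr by blast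
    show ?thesis
      unfolding bij_betw_def
    proof
      show "inj_on (\<lambda>x. x \<triangleright>\<^bsub>?P\<^esub> y) (carrier ?P)"
      proof (rule inj_onI)
        fix a b assume "a \<in> carrier ?P" "b \<in> carrier ?P" and e: "a \<triangleright>\<^bsub>?P\<^esub> y = b \<triangleright>\<^bsub>?P\<^esub> y"
        then obtain r s where rs: "r \<in> rack_terms G" "a = ?c r" "s \<in> rack_terms G" "b = ?c s"
          unfolding carr by blast
        then have "?c (Op r t) = ?c (Op s t)" using e t presented_rack_op by metis
        then have "(Op r t, Op s t) \<in> rack_cong G R"
          using rs t by (simp add: eq_equiv_class_iff[OF equiv_rack_cong])
        then have "(InvOp (Op r t) t, InvOp (Op s t) t) \<in> rack_cong G R"
          using t by (auto intro: rack_cong.intros)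
        then have "(r, s) \<in> rack_cong G R"
          using rs t by (meson rack_cong.op_inv_op rack_cong.sym rack_cong.trans)
        then show "a = b" using rs eqI by simp
      qed
      have "a \<in> (\<lambda>x. x \<triangleright>\<^bsub>?P\<^esub> y) ` carrier ?P" if a: "a \<in> carrier ?P" for a
      proof -
        obtain r where r: "r \<in> rack_terms G" "a = ?c r" using a unfolding carr by blast
        have "?c (InvOp r t) \<triangleright>\<^bsub>?P\<^esub> y = a"
          using r t by (simp add: presented_rack_op eqI rack_cong.inv_op_op)
        moreover have "?c (InvOp r t) \<in> carrier ?P" using r t carr by auto
        ultimately show ?thesis by force
      qed
      moreover have "a \<triangleright>\<^bsub>?P\<^esub> y \<in> carrier ?P" if "a \<in> carrier ?P" for a
        using that t by (auto simp: carr presented_rack_op)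
      ultimately show "(\<lambda>x. x \<triangleright>\<^bsub>?P\<^esub> y) ` carrier ?P = carrier ?P" by auto
    qed
  qed
  show "x \<triangleright>\<^bsub>?P\<^esub> y \<triangleright>\<^bsub>?P\<^esub> z = x \<triangleright>\<^bsub>?P\<^esub> z \<triangleright>\<^bsub>?P\<^esub> (y \<triangleright>\<^bsub>?P\<^esub> z)"
    if "x \<in> carrier ?P" "y \<in> carrier ?P" "z \<in> carrier ?P" for x y z
  proof -
    obtain r s t where rst: "r \<in> rack_terms G" "s \<in> rack_terms G" "t \<in> rack_terms G"
        "x = ?c r" "y = ?c s" "z = ?c t"
      using \<open>x \<in> _\<close> \<open>y \<in> _\<close> \<open>z \<in> _\<close> unfolding carr by blast
    then show ?thesis using eqI[OF rack_cong.distrib[OF rst(1-3)]] by (simp add: presented_rack_op)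
  qed
qed


section \<open>Braids\<close>

text \<open>A braid word is a list of letters, read from left to right as crossings from top to bottom;
  \<open>Sig i\<close> stands for \<open>\<sigma>\<^sub>i\<close> and \<open>SigInv i\<close> for its inverse.\<close>

datatype braid_letter = Sig (position: nat) | SigInv (position: nat)

type_synonym braid_word = "braid_letter list"

definition braid_words :: "nat \<Rightarrow> braid_word set"
  where "braid_words n = {w. \<forall>l\<in>set w. 1 \<le> position l \<and> position l < n}"

inductive_set braid_cong :: "nat \<Rightarrow> (braid_word \<times> braid_word) set" for n :: nat
  where
    refl: "w \<in> braid_words n \<Longrightarrow> (w, w) \<in> braid_cong n"
  | sym: "(u, v) \<in> braid_cong n \<Longrightarrow> (v, u) \<in> braid_cong n"
  | trans: "\<lbrakk>(u, v) \<in> braid_cong n; (v, w) \<in> braid_cong n\<rbrakk> \<Longrightarrow> (u, w) \<in> braid_cong n"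
  | append: "\<lbrakk>(u, u') \<in> braid_cong n; (v, v') \<in> braid_cong n\<rbrakk>
      \<Longrightarrow> (u @ v, u' @ v') \<in> braid_cong n"
  | cancel_right: "\<lbrakk>1 \<le> i; i < n\<rbrakk> \<Longrightarrow> ([Sig i, SigInv i], []) \<in> braid_cong n"
  | cancel_left: "\<lbrakk>1 \<le> i; i < n\<rbrakk> \<Longrightarrow> ([SigInv i, Sig i], []) \<in> braid_cong n"
  | far: "\<lbrakk>1 \<le> i; i < n; 1 \<le> j; j < n; i + 2 \<le> j \<or> j + 2 \<le> i\<rbrakk>
      \<Longrightarrow> ([Sig i, Sig j], [Sig j, Sig i]) \<in> braid_cong n"
  | braid: "\<lbrakk>1 \<le> i; i + 1 < n\<rbrakk>
      \<Longrightarrow> ([Sig i, Sig (i + 1), Sig i], [Sig (i + 1), Sig i, Sig (i + 1)]) \<in> braid_cong n"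

definition braid_group :: "nat \<Rightarrow> braid_word set monoid"
  where "braid_group n =
    \<lparr>carrier = braid_words n // braid_cong n,
     mult = (\<lambda>A B. \<Union>u\<in>A. \<Union>v\<in>B. braid_cong n `` {u @ v}),
     one = braid_cong n `` {[]}\<rparr>"

lemma braid_words_simps [simp]:
  "[] \<in> braid_words n"
  "l # w \<in> braid_words n \<longleftrightarrow> 1 \<le> position l \<and> position l < n \<and> w \<in> braid_words n"
  "u @ v \<in> braid_words n \<longleftrightarrow> u \<in> braid_words n \<and> v \<in> braid_words n"
  by (auto simp: braid_words_def)

lemma equiv_braid_cong: "equiv (braid_words n) (braid_cong n)"
proof (rule equivI)
  have "(u, v) \<in> braid_cong n \<Longrightarrow> u \<in> braid_words n \<and> v \<in> braid_words n" for u v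
    by (induction rule: braid_cong.induct) auto
  then show "braid_cong n \<subseteq> braid_words n \<times> braid_words n" by auto
  show "refl_on (braid_words n) (braid_cong n)"
    by (auto simp: refl_on_def intro: braid_cong.refl)
  show "sym (braid_cong n)"
    by (intro symI) (rule braid_cong.sym)
  show "trans (braid_cong n)"
    by (intro transI) (rule braid_cong.trans)
qed

lemma braid_group_mult:
  assumes "u \<in> braid_words n" "v \<in> braid_words n"
  shows "(braid_cong n `` {u}) \<otimes>\<^bsub>braid_group n\<^esub> (braid_cong n `` {v}) = braid_cong n `` {u @ v}"
proof -
  have "congruent2 (braid_cong n) (braid_cong n) (\<lambda>u v. braid_cong n `` {u @ v})"
    by (intro congruent2I' equiv_class_eq[OF equiv_braid_cong] braid_cong.append)
  then show ?thesis
    using assms by (simp add: braid_group_def UN_equiv_class2[OF equiv_braid_cong equiv_braid_cong])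
qed

lemma braid_left_inverse:
  "w \<in> braid_words n \<Longrightarrow> \<exists>v\<in>braid_words n. (v @ w, []) \<in> braid_cong n"
proof (induction w)
  case Nil
  have "([] @ [], []) \<in> braid_cong n" by (simp add: braid_cong.refl)
  then show ?case using braid_words_simps(1) by blast
next
  case (Cons l w)
  then obtain v where v: "v \<in> braid_words n" "(v @ w, []) \<in> braid_cong n" by auto
  obtain l' where l': "position l' = position l" "([l', l], []) \<in> braid_cong n"
    using Cons.prems braid_cong.cancel_left[of "position l" n] braid_cong.cancel_right[of "position l" n]
    by (cases l) (metis braid_letter.sel braid_words_simps(2))+
  have "(v @ [l', l] @ w, v @ [] @ w) \<in> braid_cong n"
    using l' v Cons.prems by (intro braid_cong.append braid_cong.refl) auto
  then have "((v @ [l']) @ l # w, []) \<in> braid_cong n"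
    using v braid_cong.trans by fastforce
  then show ?case using v l' Cons.prems by (intro bexI[of _ "v @ [l']"]) auto
qed

lemma carrier_braid_group:
  "carrier (braid_group n) = (\<lambda>w. braid_cong n `` {w}) ` braid_words n"
  by (auto simp: braid_group_def quotient_def)

lemma group_braid_group: "group (braid_group n)"
proof (rule groupI)
  let ?c = "\<lambda>w. braid_cong n `` {w}"
  note carr = carrier_braid_group
  have one: "\<one>\<^bsub>braid_group n\<^esub> = ?c []" by (simp add: braid_group_def)
  show "\<one>\<^bsub>braid_group n\<^esub> \<in> carrier (braid_group n)" by (auto simp: carr one)
  fix x assume x: "x \<in> carrier (braid_group n)"
  then obtain w where w: "w \<in> braid_words n" "x = ?c w" by (auto simp: carr)
  show "\<one>\<^bsub>braid_group n\<^esub> \<otimes>\<^bsub>braid_group n\<^esub> x = x" by (simp add: w one braid_group_mult)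
  show "\<exists>y\<in>carrier (braid_group n). y \<otimes>\<^bsub>braid_group n\<^esub> x = \<one>\<^bsub>braid_group n\<^esub>"
    using braid_left_inverse[OF w(1)] equiv_class_eq[OF equiv_braid_cong]
    by (fastforce simp: carr one w braid_group_mult)
qed (auto simp: carrier_braid_group braid_group_mult)


section \<open>Colorings\<close>

text \<open>The coloring rule at a single crossing. It is stated for arbitrary operations \<open>f\<close>, \<open>g\<close> in the
  roles of \<open>\<triangleright>\<close>, \<open>\<triangleright>\<^sup>-\<^sup>1\<close>, since it is used both for labels in a rack and for
  formal terms in the generators of a presentation.\<close>

fun color_step :: "('a \<Rightarrow> 'a \<Rightarrow> 'a) \<Rightarrow> ('a \<Rightarrow> 'a \<Rightarrow> 'a) \<Rightarrow> braid_letter \<Rightarrow> (nat \<Rightarrow> 'a) \<Rightarrow> (nat \<Rightarrow> 'a)"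
  where
    "color_step f g (Sig i) c = c(i := c (i + 1), i + 1 := f (c i) (c (i + 1)))"
  | "color_step f g (SigInv i) c = c(i := g (c (i + 1)) (c i), i + 1 := c i)"

definition color_word :: "('a, 'b) rack_scheme \<Rightarrow> braid_word \<Rightarrow> (nat \<Rightarrow> 'a) \<Rightarrow> (nat \<Rightarrow> 'a)"
  where "color_word X w = fold (color_step (rack_op X) (rack_inv_op X)) w"

text \<open>The set \<open>X\<^sup>n\<close>, with positions numbered from 1.\<close>

definition colorings :: "('a, 'b) rack_scheme \<Rightarrow> nat \<Rightarrow> (nat \<Rightarrow> 'a) set"
  where "colorings X n = {1..n} \<rightarrow>\<^sub>E carrier X"

definition extends_through ::
    "('a, 'b) rack_scheme \<Rightarrow> braid_word set \<Rightarrow> (nat \<Rightarrow> 'a) \<Rightarrow> (nat \<Rightarrow> 'a) \<Rightarrow> bool"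
  where "extends_through X B c d \<longleftrightarrow> (\<exists>w\<in>B. color_word X w c = d)"

lemma color_word_in_colorings:
  assumes "rack X" "c \<in> colorings X n"
  shows "w \<in> braid_words n \<Longrightarrow> color_word X w c \<in> colorings X n"
  using assms(2)
proof (induction w arbitrary: c)
  case (Cons l w)
  interpret rack X by fact
  have "color_step (rack_op X) (rack_inv_op X) l c \<in> colorings X n"
    using Cons.prems by (cases l)
      (auto simp: colorings_def PiE_iff extensional_def intro!: op_closed inv_op_closed)
  then show ?case using Cons by (simp add: color_word_def)
qed (simp add: color_word_def)

lemma color_word_cong:
  assumes "rack X" "(u, v) \<in> braid_cong n" "c \<in> colorings X n"
  shows "color_word X u c = color_word X v c"
proof -
  interpret rack X by fact
  have app: "color_word X (u @ v) c = color_word X v (color_word X u c)" for u v c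
    by (simp add: color_word_def)
  have in_carrier: "c i \<in> carrier X" if "c \<in> colorings X n" "1 \<le> i" "i \<le> n" for c i
    using that by (auto simp: colorings_def PiE_iff)
  show ?thesis
    using assms(2,3)
  proof (induction arbitrary: c)
    case (append u u' v v')
    have "u \<in> braid_words n"
      using append.hyps(1) equiv_braid_cong unfolding equiv_def by blast
    then show ?case
      using append color_word_in_colorings[OF \<open>rack X\<close>] by (metis app)
  next
    case (far i j)
    then show ?case by (auto simp: color_word_def fun_eq_iff)
  next
    case (braid i)
    then show ?case
      using distrib[of "c i" "c (i + 1)" "c (i + 2)"]
      by (auto simp: color_word_def fun_eq_iff in_carrier)
  qed (auto simp: color_word_def fun_eq_iff in_carrier op_inv_op inv_op_op)
qed

lemma extends_through_iff:
  assumes "rack X" "B \<in> carrier (braid_group n)" "w \<in> B" "c \<in> colorings X n"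
  shows "extends_through X B c d \<longleftrightarrow> color_word X w c = d"
proof -
  have "(w, v) \<in> braid_cong n" if "v \<in> B" for v
    using assms(2,3) that quotient_eq_iff[OF equiv_braid_cong, of B n B w v]
    by (simp add: braid_group_def)
  then show ?thesis
    unfolding extends_through_def using assms color_word_cong by metis
qed

text \<open>Matrices with rows and columns indexed by a set \<open>I\<close> are functions of two arguments,
  considered on \<open>I \<times> I\<close> only; here \<open>I = X\<^sup>n\<close>, of cardinality \<open>m\<^sup>n\<close>.\<close>

definition rack_counting_matrix ::
    "('a, 'b) rack_scheme \<Rightarrow> braid_word set \<Rightarrow> (nat \<Rightarrow> 'a) \<Rightarrow> (nat \<Rightarrow> 'a) \<Rightarrow> int"
  where "rack_counting_matrix X B i j = (if extends_through X B i j then 1 else 0)"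

definition matrix_trace :: "'i set \<Rightarrow> ('i \<Rightarrow> 'i \<Rightarrow> 'r::comm_monoid_add) \<Rightarrow> 'r"
  where "matrix_trace I M = (\<Sum>i\<in>I. M i i)"

lemma card_colorings: "card (colorings X n) = card (carrier X) ^ n"
  by (simp add: colorings_def card_PiE)


section \<open>The fundamental rack of the closure of a braid\<close>

text \<open>The generator \<open>(k, i)\<close> is the label in position \<open>i\<close> after the first \<open>k\<close> crossings of \<open>w\<close>.\<close>

definition closure_generators :: "nat \<Rightarrow> braid_word \<Rightarrow> (nat \<times> nat) set"
  where "closure_generators n w = {0..length w} \<times> {1..n}"

definition closure_relations ::
    "nat \<Rightarrow> braid_word \<Rightarrow> ((nat \<times> nat) rack_term \<times> (nat \<times> nat) rack_term) set"
  where "closure_relations n w =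
    {(Var (k + 1, i), color_step Op InvOp (w ! k) (\<lambda>j. Var (k, j)) i) | k i.
        k < length w \<and> i \<in> {1..n}}
    \<union> {(Var (length w, i), Var (0, i)) | i. i \<in> {1..n}}"

definition closure_fundamental_rack :: "nat \<Rightarrow> braid_word \<Rightarrow> (nat \<times> nat) rack_term set rack"
  where "closure_fundamental_rack n w =
    presented_rack (closure_generators n w) (closure_relations n w)"

definition rack_counting_invariant :: "('a, 'b) rack_scheme \<Rightarrow> nat \<Rightarrow> braid_word \<Rightarrow> nat"
  where "rack_counting_invariant X n w = card (rack_hom (closure_fundamental_rack n w) X)"

end

theory Submission
  imports Defs
begin

text \<open>By the universal property of a presentation, homomorphisms from the fundamental rack to
  \<open>X\<close> correspond to assignments of elements of \<open>X\<close> to the labels satisfying the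
  coloring rule at every crossing and the closing relations. Such an assignment is determined by
  its top row, which propagates through the braid word; the closing relations say that the top row
  equals the resulting bottom row. Hence homomorphisms correspond to top colorings fixed by the
  braid, and these are the \<open>1\<close>s on the diagonal of the counting matrix.\<close>

section \<open>The universal property of a rack presentation\<close>

primrec eval_rack_term :: "('a, 'b) rack_scheme \<Rightarrow> ('g \<Rightarrow> 'a) \<Rightarrow> 'g rack_term \<Rightarrow> 'a"
  where
    "eval_rack_term X f (Var g) = f g"
  | "eval_rack_term X f (Op s t) = rack_op X (eval_rack_term X f s) (eval_rack_term X f t)"
  | "eval_rack_term X f (InvOp s t) = rack_inv_op X (eval_rack_term X f s) (eval_rack_term X f t)"

text \<open>Assignments are extensional on \<open>G\<close>, to match the extensional homomorphisms
  of \<open>rack_hom\<close>; only then can restriction to generators be a bijection.\<close>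

definition presentation_solutions ::
    "'g set \<Rightarrow> ('g rack_term \<times> 'g rack_term) set \<Rightarrow> ('a, 'b) rack_scheme \<Rightarrow> ('g \<Rightarrow> 'a) set"
  where "presentation_solutions G R X = {f \<in> G \<rightarrow>\<^sub>E carrier X.
    \<forall>(s, t)\<in>R. eval_rack_term X f s = eval_rack_term X f t}"

lemma eval_rack_term_cong:
  "(\<And>g. g \<in> G \<Longrightarrow> f g = f' g) \<Longrightarrow> t \<in> rack_terms G
    \<Longrightarrow> eval_rack_term X f t = eval_rack_term X f' t"
  by (induction t) auto

lemma (in rack) eval_rack_term_closed:
  "f \<in> G \<rightarrow> carrier X \<Longrightarrow> t \<in> rack_terms G \<Longrightarrow> eval_rack_term X f t \<in> carrier X"
  by (induction t) (auto simp: op_closed inv_op_closed)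

text \<open>Rule induction: a pair from \<open>R\<close> is respected because \<open>f\<close> is a
  solution, and the cancellation and distributivity rules hold in \<open>X\<close> because all
  evaluated terms lie in its carrier.\<close>

lemma (in rack) eval_rack_term_respects_cong:
  assumes "f \<in> presentation_solutions G R X" and "(s, t) \<in> rack_cong G R"
  shows "eval_rack_term X f s = eval_rack_term X f t"
proof -
  have "f \<in> G \<rightarrow> carrier X"
    using assms(1) by (auto simp: presentation_solutions_def)
  note closed = eval_rack_term_closed[OF this]
  show ?thesis
    using assms(2)
  proof induction
    case (relation s t)
    then show ?case using assms(1) by (auto simp: presentation_solutions_def)
  qed (simp_all add: closed op_inv_op inv_op_op distrib)
qed

lemma carrier_presented_rack:
  "carrier (presented_rack G R) = (\<lambda>t. rack_cong G R `` {t}) ` rack_terms G"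
  by (auto simp: presented_rack_def quotient_def)

text \<open>A homomorphism is determined by its values on generators. Compatibility with the inverse
  operation is not part of \<open>rack_hom\<close>; it follows by applying \<phi> to the class of
  \<open>Op (InvOp s t) t\<close> and cancelling the right translation by the image of
  \<open>t\<close>.\<close>

lemma (in rack) rack_hom_presented_rack_eval:
  assumes "\<phi> \<in> rack_hom (presented_rack G R) X" and "t \<in> rack_terms G"
  shows "\<phi> (rack_cong G R `` {t}) = eval_rack_term X (\<lambda>g. \<phi> (rack_cong G R `` {Var g})) t"
proof -
  let ?c = "\<lambda>t. rack_cong G R `` {t}"
  have closed: "\<phi> (?c t) \<in> carrier X" if "t \<in> rack_terms G" for t
    using assms(1) that by (auto simp: rack_hom_def carrier_presented_rack)
  have hom: "\<phi> (?c (Op s t)) = \<phi> (?c s) \<triangleright> \<phi> (?c t)"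
    if "s \<in> rack_terms G" "t \<in> rack_terms G" for s t
  proof -
    have "\<phi> (?c s \<triangleright>\<^bsub>presented_rack G R\<^esub> ?c t) = \<phi> (?c s) \<triangleright> \<phi> (?c t)"
      using assms(1) that by (simp add: rack_hom_def carrier_presented_rack)
    then show ?thesis
      using that by (simp add: presented_rack_op)
  qed
  have hom_inv: "\<phi> (?c (InvOp s t)) = rack_inv_op X (\<phi> (?c s)) (\<phi> (?c t))"
    if "s \<in> rack_terms G" "t \<in> rack_terms G" for s t
  proof -
    have "?c (Op (InvOp s t) t) = ?c s"
      using that by (intro equiv_class_eq[OF equiv_rack_cong] rack_cong.inv_op_op)
    then have "\<phi> (?c (InvOp s t)) \<triangleright> \<phi> (?c t) = \<phi> (?c s)"
      using that hom[of "InvOp s t" t] by simp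
    then show ?thesis
      using that op_inv_op[of "\<phi> (?c (InvOp s t))" "\<phi> (?c t)"] by (simp add: closed)
  qed
  show ?thesis
    using assms(2) by (induction t) (simp_all add: hom hom_inv)
qed

text \<open>This is the universal property. Injectivity holds because generators determine a
  homomorphism, surjectivity because evaluation under a solution is constant on congruence classes.
  By the assumption on \<open>R\<close>, every relation enters \<open>rack_cong\<close>, so
  restricted homomorphisms satisfy all of them.\<close>

lemma (in rack) bij_betw_rack_hom_presentation_solutions:
  assumes R: "R \<subseteq> rack_terms G \<times> rack_terms G"
  shows "bij_betw (\<lambda>\<phi>. \<lambda>g\<in>G. \<phi> (rack_cong G R `` {Var g}))
    (rack_hom (presented_rack G R) X) (presentation_solutions G R X)"
    (is "bij_betw ?F ?H ?S")
  unfolding bij_betw_def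
proof (intro conjI equalityI subsetI)
  let ?c = "\<lambda>t. rack_cong G R `` {t}"
  \<comment> \<open>Restricting to \<open>G\<close> is harmless: a term over \<open>G\<close> never
    reads values outside \<open>G\<close>.\<close>
  have eval: "\<phi> (?c t) = eval_rack_term X (?F \<phi>) t" if "\<phi> \<in> ?H" "t \<in> rack_terms G" for \<phi> t
    using rack_hom_presented_rack_eval[OF that]
      eval_rack_term_cong[OF _ that(2), of "\<lambda>g. \<phi> (?c (Var g))" "?F \<phi>" X] by simp
  show "inj_on ?F ?H"
  proof (rule inj_onI)
    fix \<phi> \<psi> assume hyps: "\<phi> \<in> ?H" "\<psi> \<in> ?H" "?F \<phi> = ?F \<psi>"
    have "\<phi> A = \<psi> A" if A: "A \<in> carrier (presented_rack G R)" for A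
    proof -
      obtain t where t: "t \<in> rack_terms G" "A = ?c t"
        using A by (auto simp: carrier_presented_rack)
      show ?thesis
        unfolding t(2) eval[OF hyps(1) t(1)] eval[OF hyps(2) t(1)] hyps(3) ..
    qed
    moreover have "\<phi> \<in> carrier (presented_rack G R) \<rightarrow>\<^sub>E carrier X"
      "\<psi> \<in> carrier (presented_rack G R) \<rightarrow>\<^sub>E carrier X"
      using hyps by (auto simp: rack_hom_def)
    ultimately show "\<phi> = \<psi>" by (rule PiE_ext[rotated 2])
  qed
  show "f \<in> ?S" if "f \<in> ?F ` ?H" for f
  proof -
    obtain \<phi> where \<phi>: "\<phi> \<in> ?H" "f = ?F \<phi>" using \<open>f \<in> _\<close> by blast
    have "eval_rack_term X f s = eval_rack_term X f t" if "(s, t) \<in> R" for s t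
    proof -
      have st: "s \<in> rack_terms G" "t \<in> rack_terms G" using that R by auto
      have "?c s = ?c t"
        using that st by (intro equiv_class_eq[OF equiv_rack_cong] rack_cong.relation)
      then show ?thesis
        unfolding \<phi>(2) eval[OF \<phi>(1) st(1), symmetric] eval[OF \<phi>(1) st(2), symmetric] by simp
    qed
    moreover have "f \<in> G \<rightarrow>\<^sub>E carrier X"
      using \<phi> by (auto simp: rack_hom_def carrier_presented_rack)
    ultimately show ?thesis by (auto simp: presentation_solutions_def)
  qed
  show "f \<in> ?F ` ?H" if f: "f \<in> ?S" for f
  proof -
    \<comment> \<open>The inverse evaluates an arbitrary representative of the class; the next fact
      shows that the choice does not matter.\<close>
    define \<phi> where
      "\<phi> = (\<lambda>A\<in>carrier (presented_rack G R). eval_rack_term X f (SOME t. t \<in> A))"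
    have \<phi>: "\<phi> (?c t) = eval_rack_term X f t" if "t \<in> rack_terms G" for t
    proof -
      have "t \<in> ?c t" using that by (simp add: rack_cong.refl)
      then have "(t, SOME s. s \<in> ?c t) \<in> rack_cong G R"
        by (metis Image_singleton_iff someI)
      then have "eval_rack_term X f t = eval_rack_term X f (SOME s. s \<in> ?c t)"
        by (rule eval_rack_term_respects_cong[OF f])
      then show ?thesis using that by (simp add: \<phi>_def carrier_presented_rack)
    qed
    have fG: "f \<in> G \<rightarrow>\<^sub>E carrier X" using f by (simp add: presentation_solutions_def)
    then have closed: "eval_rack_term X f t \<in> carrier X" if "t \<in> rack_terms G" for t
      using that by (intro eval_rack_term_closed) auto
    have "\<phi> \<in> extensional (carrier (presented_rack G R))" by (simp add: \<phi>_def)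
    then have "\<phi> \<in> ?H"
      by (auto simp: rack_hom_def carrier_presented_rack PiE_iff \<phi> closed presented_rack_op)
    moreover have "f = ?F \<phi>"
      using fG by (auto simp: fun_eq_iff \<phi> PiE_iff extensional_def)
    ultimately show ?thesis by blast
  qed
qed

section \<open>Colorings of a closed braid\<close>

text \<open>Evaluation turns the formal coloring rule of the closure relations into the coloring
  rule in \<open>X\<close>.\<close>

lemma eval_rack_term_color_step:
  "eval_rack_term X f (color_step Op InvOp l c i)
    = color_step (rack_op X) (rack_inv_op X) l (\<lambda>j. eval_rack_term X f (c j)) i"
  by (cases l) auto

text \<open>A crossing at position \<open>p\<close> reads only positions \<open>p\<close> and
  \<open>p + 1\<close>, both in \<open>{1..n}\<close> since \<open>p < n\<close>. Rows therefore
  need to be compared only there.\<close>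

lemma color_step_cong:
  assumes "\<And>j. j \<in> {1..n} \<Longrightarrow> c j = d j"
    and "1 \<le> position l" "position l < n" "i \<in> {1..n}"
  shows "color_step f g l c i = color_step f g l d i"
  using assms by (cases l) auto

lemma color_word_take_Suc:
  "k < length w \<Longrightarrow> color_word X (take (Suc k) w) c
    = color_step (rack_op X) (rack_inv_op X) (w ! k) (color_word X (take k w) c)"
  by (simp add: color_word_def take_Suc_conv_app_nth)

lemma braid_words_nth:
  "w \<in> braid_words n \<Longrightarrow> k < length w \<Longrightarrow> 1 \<le> position (w ! k) \<and> position (w ! k) < n"
  by (simp add: braid_words_def)

lemma closure_relations_subset:
  assumes "w \<in> braid_words n"
  shows "closure_relations n w
    \<subseteq> rack_terms (closure_generators n w) \<times> rack_terms (closure_generators n w)"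
proof -
  have "color_step Op InvOp (w ! k) (\<lambda>j. Var (k, j)) i \<in> rack_terms (closure_generators n w)"
    if "k < length w" "i \<in> {1..n}" for k i
    using braid_words_nth[OF assms that(1)] that
    by (cases "w ! k") (auto simp: closure_generators_def)
  then show ?thesis
    by (auto simp: closure_relations_def closure_generators_def)
qed

lemma presentation_solutions_closure_iff:
  "f \<in> presentation_solutions (closure_generators n w) (closure_relations n w) X \<longleftrightarrow>
    f \<in> closure_generators n w \<rightarrow>\<^sub>E carrier X \<and>
    (\<forall>k<length w. \<forall>i\<in>{1..n}. f (Suc k, i)
      = color_step (rack_op X) (rack_inv_op X) (w ! k) (\<lambda>j. f (k, j)) i) \<and>
    (\<forall>i\<in>{1..n}. f (length w, i) = f (0, i))"
proof -
  let ?e = "eval_rack_term X f"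
  have "(\<forall>(s, t)\<in>closure_relations n w. ?e s = ?e t) \<longleftrightarrow>
    (\<forall>k<length w. \<forall>i\<in>{1..n}.
      ?e (Var (Suc k, i)) = ?e (color_step Op InvOp (w ! k) (\<lambda>j. Var (k, j)) i)) \<and>
    (\<forall>i\<in>{1..n}. ?e (Var (length w, i)) = ?e (Var (0, i)))"
    unfolding closure_relations_def Suc_eq_plus1 by blast
  then show ?thesis
    by (simp add: presentation_solutions_def eval_rack_term_color_step)
qed

text \<open>Induction on the number of crossings passed: the relations for the letter
  \<open>w ! k\<close> compute row \<open>Suc k\<close> from row \<open>k\<close> exactly as
  \<open>color_word\<close> does. Hence the top row determines the whole solution.\<close>

lemma closure_solution_eq_color_word:
  assumes w: "w \<in> braid_words n"
    and f: "f \<in> presentation_solutions (closure_generators n w) (closure_relations n w) X"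
  shows "k \<le> length w \<Longrightarrow> i \<in> {1..n}
    \<Longrightarrow> f (k, i) = color_word X (take k w) (\<lambda>j\<in>{1..n}. f (0, j)) i"
proof (induction k arbitrary: i)
  case 0
  then show ?case by (simp add: color_word_def)
next
  case (Suc k)
  then have k: "k < length w" by simp
  have "f (Suc k, i) = color_step (rack_op X) (rack_inv_op X) (w ! k) (\<lambda>j. f (k, j)) i"
    using f k Suc.prems by (simp add: presentation_solutions_closure_iff)
  also have "\<dots> = color_step (rack_op X) (rack_inv_op X) (w ! k)
      (color_word X (take k w) (\<lambda>j\<in>{1..n}. f (0, j))) i"
    using braid_words_nth[OF w k] Suc.prems by (intro color_step_cong[where n = n] Suc.IH) auto
  finally show ?case
    by (simp only: color_word_take_Suc[OF k])
qed

lemma bij_betw_closure_solutions_fixed_colorings: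
  assumes "rack X" and w: "w \<in> braid_words n"
  shows "bij_betw (\<lambda>f. \<lambda>i\<in>{1..n}. f (0, i))
    (presentation_solutions (closure_generators n w) (closure_relations n w) X)
    {c \<in> colorings X n. color_word X w c = c}"
    (is "bij_betw ?F ?S ?C")
proof (rule bij_betw_byWitness)
  let ?G = "closure_generators n w"
  \<comment> \<open>The inverse fills row \<open>k\<close> with the coloring that \<open>c\<close>
    induces below the first \<open>k\<close> crossings.\<close>
  let ?F' = "\<lambda>c. \<lambda>(k, i)\<in>?G. color_word X (take k w) c i"
  have colorings_ext: "c = d" if "c \<in> colorings X n" "d \<in> colorings X n"
    "\<And>i. i \<in> {1..n} \<Longrightarrow> c i = d i" for c d
    using that unfolding colorings_def by (rule PiE_ext)
  have take_colorings: "color_word X (take k w) c \<in> colorings X n" if "c \<in> colorings X n" for c k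
    using w set_take_subset[of k w]
    by (intro color_word_in_colorings[OF \<open>rack X\<close> that]) (auto simp: braid_words_def)
  have top: "?F f \<in> colorings X n" if "f \<in> ?S" for f
    using that unfolding presentation_solutions_closure_iff
    by (auto simp: colorings_def closure_generators_def PiE_iff)
  show "\<forall>f\<in>?S. ?F' (?F f) = f"
  proof
    fix f assume f: "f \<in> ?S"
    have ext: "f \<in> extensional ?G"
      using f by (simp add: presentation_solutions_closure_iff PiE_iff)
    show "?F' (?F f) = f"
    proof (rule extensionalityI[OF _ ext])
      show "?F' (?F f) x = f x" if "x \<in> ?G" for x
        using that closure_solution_eq_color_word[OF w f]
        by (cases x) (simp add: closure_generators_def)
    qed simp
  qed
  show "\<forall>c\<in>?C. ?F (?F' c) = c"
  proof
    fix c assume "c \<in> ?C"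
    then have "c \<in> extensional {1..n}" by (simp add: colorings_def PiE_iff)
    \<comment> \<open>Row 0 uses the empty prefix, so it is \<open>c\<close> itself; outside
      \<open>{1..n}\<close> both sides are \<open>undefined\<close>.\<close>
    then show "?F (?F' c) = c"
      by (auto simp: fun_eq_iff closure_generators_def color_word_def extensional_def)
  qed
  show "?F ` ?S \<subseteq> ?C"
  proof (rule image_subsetI)
    fix f assume f: "f \<in> ?S"
    have "color_word X w (?F f) i = ?F f i" if "i \<in> {1..n}" for i
    proof -
      have "color_word X w (?F f) i = f (length w, i)"
        using closure_solution_eq_color_word[OF w f order_refl that] by simp
      also have "\<dots> = f (0, i)"
        using f that by (simp add: presentation_solutions_closure_iff)
      finally show ?thesis using that by simp
    qed
    \<comment> \<open>Both sides are extensional colorings, so agreement on \<open>{1..n}\<close>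
      suffices.\<close>
    then have "color_word X w (?F f) = ?F f"
      using take_colorings[OF top[OF f], of "length w"] top[OF f]
      by (intro colorings_ext) simp_all
    then show "?F f \<in> ?C" using top[OF f] by simp
  qed
  show "?F' ` ?C \<subseteq> ?S"
  proof (rule image_subsetI)
    fix c assume "c \<in> ?C"
    then have c: "c \<in> colorings X n" "color_word X w c = c" by auto
    have "?F' c (Suc k, i) = color_step (rack_op X) (rack_inv_op X) (w ! k) (\<lambda>j. ?F' c (k, j)) i"
      if k: "k < length w" and i: "i \<in> {1..n}" for k i
    proof -
      have "?F' c (Suc k, i)
          = color_step (rack_op X) (rack_inv_op X) (w ! k) (color_word X (take k w) c) i"
        using that by (simp add: closure_generators_def color_word_take_Suc)
      also have "\<dots> = color_step (rack_op X) (rack_inv_op X) (w ! k) (\<lambda>j. ?F' c (k, j)) i"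
        using braid_words_nth[OF w k] that
        by (intro color_step_cong[where n = n]) (auto simp: closure_generators_def)
      finally show ?thesis .
    qed
    moreover have "?F' c \<in> ?G \<rightarrow>\<^sub>E carrier X"
      using take_colorings[OF c(1)]
      by (auto simp: closure_generators_def colorings_def PiE_iff)
    \<comment> \<open>The closing relations express precisely that \<open>c\<close> is fixed by
      \<open>w\<close>.\<close>
    moreover have "?F' c (length w, i) = ?F' c (0, i)" if "i \<in> {1..n}" for i
      using that c(2) by (simp add: closure_generators_def color_word_def)
    ultimately show "?F' c \<in> ?S" unfolding presentation_solutions_closure_iff by blast
  qed
qed

text \<open>The representative \<open>w\<close> decides each diagonal entry: it is 1 if
  \<open>w\<close> fixes the coloring and 0 otherwise. The trace thus sums an indicator function
  over a finite set.\<close>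

lemma matrix_trace_rack_counting_matrix:
  assumes "rack X" "finite (carrier X)" "B \<in> carrier (braid_group n)" "w \<in> B"
  shows "matrix_trace (colorings X n) (rack_counting_matrix X B)
    = int (card {c \<in> colorings X n. color_word X w c = c})"
proof -
  have "finite (colorings X n)"
    using assms(2) by (simp add: colorings_def finite_PiE)
  moreover have "matrix_trace (colorings X n) (rack_counting_matrix X B)
      = (\<Sum>c\<in>colorings X n. if color_word X w c = c then 1 else 0)"
    using extends_through_iff[OF assms(1,3,4)]
    by (simp add: matrix_trace_def rack_counting_matrix_def)
  ultimately show ?thesis
    by (simp flip: sum.inter_filter)
qed

theorem proposition5p10:
  fixes X :: "('a, 'b) rack_scheme" and n m :: nat and B :: "braid_word set" and w :: braid_word
  assumes "n \<ge> 1"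
    and "rack X" and "finite (carrier X)" and "card (carrier X) = m"
    and "B \<in> carrier (braid_group n)"
    and "w \<in> B"
  shows "finite (rack_hom (closure_fundamental_rack n w) X)
    \<and> rack_counting_invariant X n w = card (rack_hom (closure_fundamental_rack n w) X)
    \<and> int (card (rack_hom (closure_fundamental_rack n w) X))
        = matrix_trace (colorings X n) (rack_counting_matrix X B)"
proof -
  have w: "w \<in> braid_words n"
    using assms(5,6) equiv_class_subset[OF equiv_braid_cong]
    by (auto simp: carrier_braid_group dest: equiv_type[OF equiv_braid_cong, THEN subsetD])
  have "bij_betw (\<lambda>f. \<lambda>i\<in>{1..n}. f (0, i))
      (presentation_solutions (closure_generators n w) (closure_relations n w) X)
      {c \<in> colorings X n. color_word X w c = c}"
    using assms(2) w by (rule bij_betw_closure_solutions_fixed_colorings)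
  from bij_betw_trans[OF
      rack.bij_betw_rack_hom_presentation_solutions[OF assms(2) closure_relations_subset[OF w]] this]
  obtain F where F: "bij_betw F (rack_hom (closure_fundamental_rack n w) X)
      {c \<in> colorings X n. color_word X w c = c}"
    unfolding closure_fundamental_rack_def by blast
  \<comment> \<open>Finiteness is carried along the bijection to the set of homomorphisms, so its
    \<open>card\<close> is a genuine count and not the default 0 of an infinite set.\<close>
  have "finite {c \<in> colorings X n. color_word X w c = c}"
    using assms(3) by (simp add: colorings_def finite_PiE)
  then show ?thesis
    using bij_betw_finite[OF F] bij_betw_same_card[OF F]
      matrix_trace_rack_counting_matrix[OF assms(2,3,5,6)]
    by (simp add: rack_counting_invariant_def)
qed

end
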